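(* If $G$ is a finite bipartite graph, then $\rho^{\rm o}(G\,\square\, K_2)=2\rho_2(G)$.
   Context: Graphs are finite, simple and undirected. For a vertex $x$ of a graph $G$, $N(x)$ is the set of vertices adjacent to $x$ and $N[x]=N(x)\cup\{x\}$. A set $X\subseteq V(G)$ is a $2$-packing of $G$ if $N[x]\cap N[y]=\emptyset$ for every pair of distinct $x,y\in X$; $\rho_2(G)$ is the maximum cardinality of a $2$-packing of $G$. A set $X\subseteq V(G)$ is an open packing of $G$ if $N(x)\cap N(y)=\emptyset$ for every pair of distinct $x,y\in X$ (two vertices of an open packing may be adjacent); $\rho^{\rm o}(G)$ is the maximum cardinality of an open packing of $G$. The Cartesian product $G\,\square\, H$ has vertex set $V(G)\times V(H)$, with $(g_1,h_1)$ and $(g_2,h_2)$ adjacent if either $g_1=g_2$ and $h_1h_2\in E(H)$, or $h_1=h_2$ and $g_1g_2\in E(G)$. $K_2$ is the complete graph on two vertices. *)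

theory Defs
  imports "Graph_Theory.Kuratowski"
begin

text \<open>
  A finite simple undirected graph is a \<^locale>\<open>pair_graph\<close>: a finite loop-free digraph whose
  arcs are ordered pairs of vertices and whose arc relation is symmetric, so that an edge between
  \<open>u\<close> and \<open>v\<close> is the pair of arcs \<open>(u, v)\<close>, \<open>(v, u)\<close>.
\<close>

definition nbhd :: "'a pair_pre_digraph \<Rightarrow> 'a \<Rightarrow> 'a set" where
  "nbhd G x = {y. (x, y) \<in> parcs G}"

definition closed_nbhd :: "'a pair_pre_digraph \<Rightarrow> 'a \<Rightarrow> 'a set" where
  "closed_nbhd G x = nbhd G x \<union> {x}"

definition bipartite :: "'a pair_pre_digraph \<Rightarrow> bool" where
  "bipartite G \<longleftrightarrow> (\<exists>A B. A \<union> B = pverts G \<and> A \<inter> B = {} \<and>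
     (\<forall>(u, v) \<in> parcs G. (u \<in> A \<and> v \<in> B) \<or> (u \<in> B \<and> v \<in> A)))"

definition two_packing :: "'a pair_pre_digraph \<Rightarrow> 'a set \<Rightarrow> bool" where
  "two_packing G X \<longleftrightarrow> X \<subseteq> pverts G \<and>
     (\<forall>x \<in> X. \<forall>y \<in> X. x \<noteq> y \<longrightarrow> closed_nbhd G x \<inter> closed_nbhd G y = {})"

definition open_packing :: "'a pair_pre_digraph \<Rightarrow> 'a set \<Rightarrow> bool" where
  "open_packing G X \<longleftrightarrow> X \<subseteq> pverts G \<and>
     (\<forall>x \<in> X. \<forall>y \<in> X. x \<noteq> y \<longrightarrow> nbhd G x \<inter> nbhd G y = {})"

text \<open>
  On a finite graph both maxima range over a finite set of naturals that contains 0, since the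
  empty set is a packing.
\<close>

definition rho2 :: "'a pair_pre_digraph \<Rightarrow> nat" where
  "rho2 G = Max {card X |X. two_packing G X}"

definition rho_open :: "'a pair_pre_digraph \<Rightarrow> nat" where
  "rho_open G = Max {card X |X. open_packing G X}"

text \<open>
  The fixed coordinate has to be a vertex explicitly; otherwise an arc \<open>(h1, h2)\<close> of \<open>H\<close> would give
  an arc \<open>((g, h1), (g, h2))\<close> for every \<open>g\<close> of the type.
\<close>

definition cart_prod ::
  "'a pair_pre_digraph \<Rightarrow> 'b pair_pre_digraph \<Rightarrow> ('a \<times> 'b) pair_pre_digraph" (infixl "\<box>" 75) where
  "G \<box> H = \<lparr> pverts = pverts G \<times> pverts H,
     parcs = {((g1, h1), (g2, h2)) |g1 h1 g2 h2.
       (g1 = g2 \<and> g1 \<in> pverts G \<and> (h1, h2) \<in> parcs H) \<or>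
       (h1 = h2 \<and> h1 \<in> pverts H \<and> (g1, g2) \<in> parcs G)} \<rparr>"

lemma pair_graph_cart_prod:
  assumes "pair_graph G" "pair_graph H"
  shows "pair_graph (G \<box> H)"
proof -
  interpret G: pair_graph G by fact
  interpret H: pair_graph H by fact
  have sub: "parcs (G \<box> H) \<subseteq> (pverts G \<times> pverts H) \<times> (pverts G \<times> pverts H)"
    by (auto simp: cart_prod_def dest: G.wellformed' H.wellformed')
  have sG: "(u, v) \<in> parcs G \<Longrightarrow> (v, u) \<in> parcs G" for u v
    using G.pair_sym_arcs by (auto simp: symmetric_def dest: symD)
  have sH: "(u, v) \<in> parcs H \<Longrightarrow> (v, u) \<in> parcs H" for u v
    using H.pair_sym_arcs by (auto simp: symmetric_def dest: symD)
  show ?thesis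
  proof
    show "finite (parcs (G \<box> H))"
      using sub by (rule finite_subset) (simp add: G.pair_finite_verts H.pair_finite_verts)
    show "symmetric (with_proj (G \<box> H))"
      by (auto simp: symmetric_def cart_prod_def intro!: symI dest: sG sH)
    show "fst e \<noteq> snd e" if "e \<in> parcs (G \<box> H)" for e
      using that G.pair_no_loops H.pair_no_loops by (fastforce simp: cart_prod_def)
  qed (auto simp: cart_prod_def G.pair_finite_verts H.pair_finite_verts
      dest: G.wellformed' H.wellformed')
qed

end

theory Submission
  imports Defs
begin

text \<open>
  If \<open>X\<close> is a 2-packing of \<open>G\<close>, then \<open>X \<times> V(K\<^sub>2)\<close> is an open packing, because the projection to \<open>G\<close>
  maps the neighbourhood of \<open>(x, h)\<close> into \<open>N[x]\<close>. Conversely, let \<open>c\<close> be a proper 2-colouring of \<open>G\<close>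
  with values in \<open>V(K\<^sub>2)\<close> and \<open>c'\<close> the opposite colouring. If \<open>z \<in> N[x]\<close>, then \<open>(z, c z)\<close> is a
  neighbour of \<open>(x, c' x)\<close>: for \<open>z = x\<close> the layers differ, and for \<open>z \<in> N(x)\<close> we have \<open>c z = c' x\<close>.
  So the part of an open packing on the graph of \<open>c'\<close> projects injectively to a 2-packing of \<open>G\<close>. The
  graphs of \<open>c\<close> and \<open>c'\<close> partition the product, hence every open packing has size at most
  \<open>2 \<rho>\<^sub>2(G)\<close>.
\<close>

text \<open>Keeping one class \<open>A\<close> and using its complement as the other makes the
  colouring total on the type, so it can be written with a single \<open>if\<close>.\<close>

lemma bipartite_colouring:
  assumes "bipartite G"
  obtains A where "\<And>u v. (u, v) \<in> parcs G \<Longrightarrow> u \<in> A \<longleftrightarrow> v \<notin> A"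
proof -
  obtain A B where "A \<inter> B = {}"
    and AB: "\<forall>(u, v) \<in> parcs G. (u \<in> A \<and> v \<in> B) \<or> (u \<in> B \<and> v \<in> A)"
    using assms by (auto simp: bipartite_def)
  have "u \<in> A \<longleftrightarrow> v \<notin> A" if "(u, v) \<in> parcs G" for u v
    using bspec[OF AB that] \<open>A \<inter> B = {}\<close> by auto
  then show ?thesis
    by (rule that)
qed

lemma finite_card_two_packing:
  assumes "finite (pverts G)"
  shows "finite {card X |X. two_packing G X}"
proof (rule finite_subset)
  show "{card X |X. two_packing G X} \<subseteq> card ` Pow (pverts G)"
    by (auto simp: two_packing_def)
qed (use assms in simp)

lemma card_le_rho2:
  assumes "finite (pverts G)" "two_packing G X"
  shows "card X \<le> rho2 G"
  unfolding rho2_def using finite_card_two_packing[OF assms(1)] assms(2) by (intro Max_ge) auto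

lemma obtain_rho2:
  assumes "finite (pverts G)"
  obtains X where "two_packing G X" "card X = rho2 G"
proof -
  have "two_packing G {}"
    by (simp add: two_packing_def)
  then have "rho2 G \<in> {card X |X. two_packing G X}"
    unfolding rho2_def using finite_card_two_packing[OF assms] by (intro Max_in) auto
  then show ?thesis
    using that by auto
qed

text \<open>Writing the opposite layer as \<open>{a, b} - {h}\<close> treats both layers at
  once.\<close>

lemma nbhd_cart_prod_complete2:
  assumes "a \<noteq> b" and H: "pverts H = {a, b}" "parcs H = {(a, b), (b, a)}"
    and "x \<in> pverts G" "h \<in> pverts H"
  shows "nbhd (G \<box> H) (x, h) = nbhd G x \<times> {h} \<union> {x} \<times> ({a, b} - {h})"
proof -
  have "(h, k) \<in> parcs H \<longleftrightarrow> k \<in> {a, b} - {h}" for k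
    using assms(1,5) by (auto simp: H)
  then show ?thesis
    using assms(4,5) by (simp add: nbhd_def cart_prod_def) blast
qed

lemma open_packing_times:
  assumes "pair_graph G" "a \<noteq> b" and H: "pverts H = {a, b}" "parcs H = {(a, b), (b, a)}"
    and X: "two_packing G X"
  shows "open_packing (G \<box> H) (X \<times> {a, b})"
  unfolding open_packing_def
proof (intro conjI ballI impI)
  interpret pair_graph G by fact
  have sub: "X \<subseteq> pverts G"
    using X by (simp add: two_packing_def)
  then show "X \<times> {a, b} \<subseteq> pverts (G \<box> H)"
    using H by (auto simp: cart_prod_def)
  fix p q assume "p \<in> X \<times> {a, b}" "q \<in> X \<times> {a, b}" "p \<noteq> q"
  then obtain x h y k where pq: "p = (x, h)" "q = (y, k)" and
    in_X: "x \<in> X" "y \<in> X" "h \<in> {a, b}" "k \<in> {a, b}" and ne: "x \<noteq> y \<or> h \<noteq> k"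
    by blast
  have "x \<in> pverts G" "y \<in> pverts G" "h \<in> pverts H" "k \<in> pverts H"
    using in_X sub H by auto
  then have nb: "nbhd (G \<box> H) p = nbhd G x \<times> {h} \<union> {x} \<times> ({a, b} - {h})"
    "nbhd (G \<box> H) q = nbhd G y \<times> {k} \<union> {y} \<times> ({a, b} - {k})"
    unfolding pq by (simp_all add: nbhd_cart_prod_complete2[OF assms(2) H])
  \<comment> \<open>Needed for the two copies of one vertex: their neighbourhoods could meet only in
    a copy of \<open>x\<close> itself, which would put \<open>x\<close> into
    \<open>nbhd G x\<close>.\<close>
  have irrefl: "x \<notin> nbhd G x"
    using pair_no_loops by (fastforce simp: nbhd_def)
  show "nbhd (G \<box> H) p \<inter> nbhd (G \<box> H) q = {}"
  proof (cases "x = y")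
    case True
    then show ?thesis
      using ne irrefl in_X unfolding nb by auto
  next
    case False
    then have "closed_nbhd G x \<inter> closed_nbhd G y = {}"
      using X in_X by (auto simp: two_packing_def)
    then show ?thesis
      unfolding nb closed_nbhd_def by auto
  qed
qed

text \<open>The colourings stay abstract so that the lemma can be used a second time with
  \<open>c\<close> and \<open>c'\<close> exchanged.\<close>

lemma two_packing_section:
  fixes c c' :: "'a \<Rightarrow> 'b"
  assumes "a \<noteq> b" and H: "pverts H = {a, b}" "parcs H = {(a, b), (b, a)}"
    and c: "\<And>x. {c x, c' x} = {a, b}" "\<And>u v. (u, v) \<in> parcs G \<Longrightarrow> c v = c' u"
    and P: "open_packing (G \<box> H) P"
  shows "two_packing G {x. (x, c' x) \<in> P}"
  unfolding two_packing_def
proof (intro conjI ballI impI)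
  show sub: "{x. (x, c' x) \<in> P} \<subseteq> pverts G"
    using P by (auto simp: open_packing_def cart_prod_def)
  have lift: "(z, c z) \<in> nbhd (G \<box> H) (x, c' x)"
    if "z \<in> closed_nbhd G x" "(x, c' x) \<in> P" for x z
  proof -
    \<comment> \<open>As \<open>a \<noteq> b\<close>, the equation
      \<open>{c x, c' x} = {a, b}\<close> forces \<open>c x \<noteq> c' x\<close>.\<close>
    have "c z \<in> {a, b} - {c' x}" if "z = x"
      using c(1)[of x] \<open>a \<noteq> b\<close> that by (auto simp: doubleton_eq_iff)
    moreover have "c' x \<in> pverts H"
      using c(1)[of x] H by auto
    ultimately show ?thesis
      using that sub c(2)
        nbhd_cart_prod_complete2[OF \<open>a \<noteq> b\<close> H, of x G "c' x"]
      by (auto simp: closed_nbhd_def nbhd_def[of G])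
  qed
  fix x y assume "x \<in> {x. (x, c' x) \<in> P}" "y \<in> {x. (x, c' x) \<in> P}" "x \<noteq> y"
  then have "nbhd (G \<box> H) (x, c' x) \<inter> nbhd (G \<box> H) (y, c' y) = {}"
    "(x, c' x) \<in> P" "(y, c' y) \<in> P"
    using P by (auto simp: open_packing_def)
  \<comment> \<open>A common element \<open>z\<close> would give the common neighbour
    \<open>(z, c z)\<close> in the product.\<close>
  then show "closed_nbhd G x \<inter> closed_nbhd G y = {}"
    using lift by blast
qed

lemma card_open_packing_le:
  assumes "pair_graph G" "bipartite G"
    and "a \<noteq> b" and H: "pverts H = {a, b}" "parcs H = {(a, b), (b, a)}"
    and P: "open_packing (G \<box> H) P"
  shows "card P \<le> 2 * rho2 G"
proof -
  interpret pair_graph G by fact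
  obtain A where A: "\<And>u v. (u, v) \<in> parcs G \<Longrightarrow> u \<in> A \<longleftrightarrow> v \<notin> A"
    using bipartite_colouring[OF assms(2)] by blast
  define c where "c x = (if x \<in> A then a else b)" for x
  define c' where "c' x = (if x \<in> A then b else a)" for x
  let ?X = "{x. (x, c x) \<in> P}" and ?X' = "{x. (x, c' x) \<in> P}"
  have "two_packing G ?X'"
    by (rule two_packing_section[where c = c, OF \<open>a \<noteq> b\<close> H _ _ P]) (use A in \<open>auto simp: c_def c'_def\<close>)
  moreover have "two_packing G ?X"
    by (rule two_packing_section[where c = c', OF \<open>a \<noteq> b\<close> H _ _ P]) (use A in \<open>auto simp: c_def c'_def\<close>)
  ultimately have le: "card ?X \<le> rho2 G" "card ?X' \<le> rho2 G"
    and fin: "finite ?X" "finite ?X'"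
    using card_le_rho2 pair_finite_verts by (blast, blast, auto simp: two_packing_def intro: finite_subset)
  have "P \<subseteq> pverts G \<times> {a, b}"
    using P by (simp add: open_packing_def cart_prod_def H)
  \<comment> \<open>Over each \<open>x\<close> the two colours exhaust \<open>{a, b}\<close>, so
    every vertex of \<open>P\<close> lies on one of the two graphs.\<close>
  then have "P \<subseteq> (\<lambda>x. (x, c x)) ` ?X \<union> (\<lambda>x. (x, c' x)) ` ?X'"
    by (force simp: c_def c'_def image_iff)
  then have "card P \<le> card ((\<lambda>x. (x, c x)) ` ?X \<union> (\<lambda>x. (x, c' x)) ` ?X')"
    using fin by (intro card_mono) auto
  also have "\<dots> \<le> card ?X + card ?X'"
    by (intro order_trans[OF card_Un_le] add_mono card_image_le fin)
  finally show ?thesis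
    using le by simp
qed

text \<open>Unfolds the library's complete digraph into the explicit two-vertex form that the other
  lemmas assume.\<close>

lemma complete2_pair_digraph:
  assumes "K\<^bsub>2\<^esub> (with_proj H)"
  obtains a b where "a \<noteq> b" "pverts H = {a, b}" "parcs H = {(a, b), (b, a)}"
proof -
  have "card (pverts H) = 2"
    and arcs: "parcs H = {(u, v). (u, v) \<in> pverts H \<times> pverts H \<and> u \<noteq> v}"
    using assms by (auto simp: complete_digraph_def arcs_ends_def arc_to_ends_def)
  then obtain a b where "pverts H = {a, b}" "a \<noteq> b"
    by (auto simp: card_2_iff)
  with arcs show ?thesis
    by (intro that[of a b]) auto
qed

theorem theorem2p2:
  fixes G :: "'a pair_pre_digraph" and H :: "'b pair_pre_digraph"
  assumes "pair_graph G" and "bipartite G"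
    and "K\<^bsub>2\<^esub> (with_proj H)"
  shows "rho_open (G \<box> H) = 2 * rho2 G"
proof -
  interpret pair_graph G by fact
  obtain a b where ab: "a \<noteq> b" and H: "pverts H = {a, b}" "parcs H = {(a, b), (b, a)}"
    using complete2_pair_digraph[OF assms(3)] by blast
  have upper: "card P \<le> 2 * rho2 G" if "open_packing (G \<box> H) P" for P
    using card_open_packing_le[OF assms(1,2) ab H that] .
  obtain X where X: "two_packing G X" "card X = rho2 G"
    using obtain_rho2 pair_finite_verts by blast
  have "card (X \<times> {a, b}) = 2 * rho2 G"
    using X(2) ab by (simp add: card_cartesian_product)
  then have "2 * rho2 G \<in> {card P |P. open_packing (G \<box> H) P}"
    using open_packing_times[OF assms(1) ab H X(1)] by (metis (mono_tags, lifting) mem_Collect_eq)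
  \<comment> \<open>The upper bound already confines these cardinalities to an initial segment of
    the naturals.\<close>
  moreover have "finite {card P |P. open_packing (G \<box> H) P}"
    by (rule finite_subset[of _ "{..2 * rho2 G}"]) (use upper in auto)
  ultimately show ?thesis
    unfolding rho_open_def using upper by (intro Max_eqI) auto
qed

end
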